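(* Let $p_n<p_{n+1}$ be two consecutive odd primes and let $m=(p_n+p_{n+1})/2$ be their midpoint. Assume that for every integer $m_i$ with $p_n<m_i\le m$, the largest multiple of $p_n$ not exceeding $m_i^2$ is odd. Then $p_{n+1}-p_n<2\sqrt{p_n}$.
   Context: Here $p_n$ denotes the $n$-th prime; $p_n$ and $p_{n+1}$ being consecutive odd primes means that both are odd and there is no prime strictly between them. The parity assumption in the claim is the paper's "Parity conjecture" for the pair $(p_n,p_{n+1})$. *)

theory Defs
  imports Complex_Main "HOL-Computational_Algebra.Primes" "HOL-Library.Infinite_Set"
begin

(* Indexed from 1: nth_prime 1 = 2. As subtraction on nat truncates, nth_prime 0 is a junk value. *)
definition nth_prime :: "nat \<Rightarrow> nat" where
  "nth_prime n = enumerate {p. prime p} (n - 1)"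

definition consecutive_odd_primes :: "nat \<Rightarrow> nat \<Rightarrow> bool" where
  "consecutive_odd_primes p q \<longleftrightarrow>
     prime p \<and> prime q \<and> odd p \<and> odd q \<and> p < q \<and> \<not> (\<exists>r. prime r \<and> p < r \<and> r < q)"

(* The maximum exists whenever a is nonzero. *)
definition largest_multiple :: "int \<Rightarrow> int \<Rightarrow> int" where
  "largest_multiple a x = (GREATEST y. a dvd y \<and> y \<le> x)"

end

(* For k = p + j the largest multiple of p below k^2 is p (p + 2 j + floor (j^2 / p)), which for odd p
   is odd iff floor (j^2 / p) is even. The least j with j^2 \<ge> p satisfies p \<le> j^2 < 2 p, so it
   violates the parity assumption; hence j exceeds half the gap, and half the gap is below sqrt p. *)
theory Submission
  imports Defs
begin

lemma largest_multiple_eq: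
  fixes a x :: int
  assumes "a > 0"
  shows "largest_multiple a x = a * (x div a)"
  unfolding largest_multiple_def
proof (rule Greatest_equality)
  show "a dvd a * (x div a) \<and> a * (x div a) \<le> x"
    using assms by (simp add: minus_mod_eq_mult_div[symmetric])
next
  fix y
  assume y: "a dvd y \<and> y \<le> x"
  then obtain c where c: "y = a * c" by blast
  have "c = y div a" using c assms by simp
  also have "\<dots> \<le> x div a" using y assms by (intro zdiv_mono1) auto
  finally show "y \<le> a * (x div a)" using c assms by simp
qed

text \<open>Put \<open>i = j - 1\<close>. Minimality of \<open>j\<close> gives i^2 + 1 \<le> p, and
  2 (i^2 + 1) - (i + 1)^2 = (i - 1)^2, so j^2 < 2 p unless i = 1. In that case j^2 = 4, and oddness
  excludes p = 2.\<close>

lemma square_between_odd_and_double: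
  fixes p :: nat
  assumes "odd p" "p > 1"
  obtains j where "p \<le> j\<^sup>2" "j\<^sup>2 < 2 * p" "\<And>h. p \<le> h\<^sup>2 \<Longrightarrow> j \<le> h"
proof -
  define j where "j = (LEAST j. p \<le> j\<^sup>2)"
  have least: "j \<le> h" if "p \<le> h\<^sup>2" for h
    unfolding j_def using that by (rule Least_le)
  have j: "p \<le> j\<^sup>2"
    unfolding j_def by (rule LeastI[of _ p]) (simp add: power2_eq_square)
  then obtain i where i: "j = Suc i"
    using assms by (cases j) auto
  have lt: "i\<^sup>2 < p"
    using least[of i] i by (meson not_less Suc_n_not_le_n)
  have "j\<^sup>2 < 2 * p"
  proof (cases "i = 1")
    case True
    then have "p \<noteq> 2" using assms by auto
    then show ?thesis using True i assms by (simp add: power2_eq_square)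
  next
    case False
    \<comment> \<open>Over \<open>int\<close> the case i = 0 is covered too, as i - 1 is not
      truncated.\<close>
    then have "0 < (int i - 1)\<^sup>2" by simp
    then have "int (j\<^sup>2) < int (2 * (i\<^sup>2 + 1))"
      using i by (simp add: power2_eq_square algebra_simps)
    then have "j\<^sup>2 < 2 * (i\<^sup>2 + 1)" by (simp only: of_nat_less_iff)
    also have "\<dots> \<le> 2 * p" using lt by simp
    finally show ?thesis .
  qed
  with j least that show thesis by blast
qed

theorem theorem1:
  fixes n :: nat and m :: real
  assumes "n \<ge> 1"
    and "consecutive_odd_primes (nth_prime n) (nth_prime (n + 1))"
    and "m = (real (nth_prime n) + real (nth_prime (n + 1))) / 2"
    and "\<forall>k::int. int (nth_prime n) < k \<and> real_of_int k \<le> m \<longrightarrow>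
           odd (largest_multiple (int (nth_prime n)) (k ^ 2))"
  shows "real (nth_prime (n + 1)) - real (nth_prime n) < 2 * sqrt (real (nth_prime n))"
proof (rule ccontr)
  define p q where "p = nth_prime n" and "q = nth_prime (n + 1)"
  assume "\<not> ?thesis"
  then have gap: "2 * sqrt (real p) \<le> real q - real p"
    by (simp add: p_def q_def)
  have pq: "prime p" "odd p" "odd q" "p < q"
    using assms(2) by (auto simp: consecutive_odd_primes_def p_def q_def)
  \<comment> \<open>Half the gap is a natural number \<open>h\<close>, so the midpoint is the
    integer p + h.\<close>
  have "even (q - p)" using pq by simp
  then obtain h where h: "q - p = 2 * h" by blast
  then have q: "q = p + 2 * h" using pq by simp
  have "sqrt (real p) \<le> real h" using gap q by simp
  then have "real p \<le> real h ^ 2" by (rule sqrt_le_D)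
  \<comment> \<open>The negated goal thus makes \<open>h\<close> a competitor in the minimality of
    \<open>j\<close>, which forces j \<le> h.\<close>
  then have "p \<le> h\<^sup>2" by (metis of_nat_le_iff of_nat_power)
  moreover obtain j where j: "p \<le> j\<^sup>2" "j\<^sup>2 < 2 * p" "\<And>h. p \<le> h\<^sup>2 \<Longrightarrow> j \<le> h"
    using square_between_odd_and_double[OF pq(2) prime_gt_1_nat[OF pq(1)]] by blast
  ultimately have "j \<le> h" by blast
  have "p > 0" using pq(1) by (rule prime_gt_0_nat)
  then have "j > 0" using j(1) by (cases j) auto
  have "m = real p + real h"
    using assms(3) q by (simp only: p_def[symmetric] q_def[symmetric]) simp
  \<comment> \<open>The bounds 0 < j \<le> h place p + j strictly above p and not beyond
    \<open>m\<close>.\<close>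
  then have "odd (largest_multiple (int p) ((int p + int j)\<^sup>2))"
    using assms(4)[rule_format, of "int p + int j"] \<open>j > 0\<close> \<open>j \<le> h\<close>
    by (simp add: p_def[symmetric])
  \<comment> \<open>The remainder is j^2 - p, which lies in [0, p) by the two bounds on j^2. As p is
    odd, this quotient is even, and so is its product with p.\<close>
  moreover have "(int p + int j)\<^sup>2 div int p = int p + 2 * int j + 1"
  proof (rule int_div_pos_eq)
    show "(int p + int j)\<^sup>2 = int p * (int p + 2 * int j + 1) + (int (j\<^sup>2) - int p)"
      by (simp add: power2_eq_square algebra_simps)
  qed (use j in linarith)+
  ultimately show False
    using pq(2) \<open>p > 0\<close> by (simp add: largest_multiple_eq)
qed

end
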